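(* Let $k\ge 2$. Denote by ${\bf y}_{k}(t)=V_{k}\exp(-tH_{k})\beta{\bf e}_{1}$ and $\widehat{\bf y}_{k}(t)=V_{k}\exp(-tT_{k})\beta{\bf e}_{1}$ the Arnoldi approximation and the harmonic Arnoldi approximation to ${\bf y}(t)=\exp(-tA){\bf v}$, respectively, and by ${\bf r}_{k}(t)=-A{\bf y}_{k}(t)-{\bf y}_{k}'(t)$ and $\widehat{\bf r}_{k}(t)=-A\widehat{\bf y}_{k}(t)-\widehat{\bf y}_{k}'(t)$ the corresponding residuals. Let ${\bf g}=\gamma h_{k+1,k}^{2}(I+\gamma H_{k})^{-\mathrm{H}}{\bf e}_{k}$. Then $$ \widehat{\bf y}_{k}(t)={\bf y}_{k}(t)+\beta V_{k}\sum_{m=2}^{\infty}\left(\frac{(-t)^{m}}{m!}\sum_{p=1}^{m-1}\big[{\bf e}_{k}^{\mathrm{H}}T_{k}^{p}{\bf e}_{1}\big]\big[H_{k}^{m-1-p}{\bf g}\big]\right) $$ and $$ \widehat{\bf r}_{k}(t)={\bf r}_{k}(t)-(h_{k+1,k}\alpha){\bf v}_{k+1}+\gamma h_{k+1,k}^{2}\Big[{\bf e}_{k}^{\mathrm{H}}\exp(-tH_{k})\beta{\bf e}_{1}+\alpha\Big]V_{k}(I+\gamma H_{k})^{-\mathrm{H}}{\bf e}_{k}, $$ where $$ \alpha=\beta\sum_{m=2}^{\infty}\left(\frac{(-t)^{m}}{m!}\sum_{p=1}^{m-1}\big[{\bf e}_{k}^{\mathrm{H}}T_{k}^{p}{\bf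 e}_{1}\big]\big[{\bf e}_{k}^{\mathrm{H}}H_{k}^{m-1-p}{\bf g}\big]\right). $$
   Context: $A$ is an $n\times n$ matrix, $t>0$, the spectrum of $-tA$ lies in the (closed) left half plane, and ${\bf v}$ is a nonzero vector with $\beta=\|{\bf v}\|_2$. The $k$-step Arnoldi process started with ${\bf v}_1={\bf v}/\beta$ is assumed to produce $V_{k+1}=[{\bf v}_1,\dots,{\bf v}_{k+1}]=[V_k,{\bf v}_{k+1}]$ with orthonormal columns (spanning the Krylov subspace $\mathrm{span}\{{\bf v}_1,A{\bf v}_1,\dots,A^k{\bf v}_1\}$), a $k\times k$ upper Hessenberg matrix $H_k$ and a real scalar $h_{k+1,k}$ with $$AV_k=V_kH_k+h_{k+1,k}{\bf v}_{k+1}{\bf e}_k^{\mathrm{H}}.$$ Here ${\bf e}_j$ is the $j$-th column of the $k\times k$ identity matrix, $(\cdot)^{\mathrm{H}}$ is the conjugate transpose, $(\cdot)^{-\mathrm{H}}$ is the inverse of the conjugate transpose, and $'$ denotes $d/dt$. The parameter $\gamma$ is a nonzero real number such that $I+\gamma H_k$ is nonsingular, and $$T_k=H_k+\gamma h_{k+1,k}^2(I+\gamma H_k)^{-\mathrm{H}}{\bf e}_k{\bf e}_k^{\mathrm{H}}.$$ *)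

theory Defs
  imports "HOL-Analysis.Derivative" "HOL-Analysis.L2_Norm" "Jordan_Normal_Form.Spectral_Radius"
begin

definition norm2 :: "complex vec \<Rightarrow> real" where
  "norm2 v = L2_set (\<lambda>i. cmod (v $ i)) {..<dim_vec v}"

definition outer_prod :: "complex vec \<Rightarrow> complex vec \<Rightarrow> complex mat" where
  "outer_prod x y = mat (dim_vec x) (dim_vec y) (\<lambda>(i, j). x $ i * cnj (y $ j))"

text \<open>Only meaningful for nonsingular square matrices, where \<open>mat_inverse\<close> returns a value.\<close>

definition inv_adjoint :: "complex mat \<Rightarrow> complex mat" where
  "inv_adjoint M = the (mat_inverse (mat_adjoint M))"

text \<open>Vectors of type \<open>complex vec\<close> carry no topology; since the dimension is fixed along each
  series or curve, convergence and derivatives are taken componentwise.\<close>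

definition vec_summable :: "nat \<Rightarrow> (nat \<Rightarrow> complex vec) \<Rightarrow> bool" where
  "vec_summable d f \<longleftrightarrow> (\<forall>i<d. summable (\<lambda>m. f m $ i))"

definition vec_suminf :: "nat \<Rightarrow> (nat \<Rightarrow> complex vec) \<Rightarrow> complex vec" where
  "vec_suminf d f = vec d (\<lambda>i. \<Sum>m. f m $ i)"

definition vec_deriv :: "(real \<Rightarrow> complex vec) \<Rightarrow> real \<Rightarrow> complex vec" where
  "vec_deriv y t = vec (dim_vec (y t)) (\<lambda>i. vector_derivative (\<lambda>s. y s $ i) (at t))"

definition mat_exp :: "complex mat \<Rightarrow> complex mat" where
  "mat_exp A = mat (dim_row A) (dim_row A) (\<lambda>(i, j). \<Sum>m. (A ^\<^sub>m m) $$ (i, j) / fact m)"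

definition upper_hessenberg :: "complex mat \<Rightarrow> bool" where
  "upper_hessenberg H \<longleftrightarrow> (\<forall>i<dim_row H. \<forall>j<dim_col H. j + 1 < i \<longrightarrow> H $$ (i, j) = 0)"

definition orthonormal_cols :: "complex mat \<Rightarrow> bool" where
  "orthonormal_cols V \<longleftrightarrow>
    (\<forall>i<dim_col V. \<forall>j<dim_col V. col V i \<bullet>c col V j = (if i = j then 1 else 0))"

abbreviation vspan :: "nat \<Rightarrow> complex vec set \<Rightarrow> complex vec set" where
  "vspan n \<equiv> LinearCombinations.module.span class_ring (module_vec TYPE(complex) n)"

text \<open>The outcome of \<open>k\<close> Arnoldi steps started with \<open>v / norm2 v\<close>: \<open>V\<close> holds the first \<open>k\<close> basis
  vectors and \<open>w\<close> is the last one. Column and unit vector indices are 0-based, so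
  \<open>unit_vec k 0\<close> and \<open>unit_vec k (k - 1)\<close> are the first and last columns of the identity.\<close>

definition arnoldi ::
  "nat \<Rightarrow> nat \<Rightarrow> complex mat \<Rightarrow> complex vec \<Rightarrow> complex mat \<Rightarrow> complex vec \<Rightarrow> complex mat \<Rightarrow> real \<Rightarrow> bool"
  where
  "arnoldi n k A v V w H h \<longleftrightarrow>
     (let v1 = complex_of_real (1 / norm2 v) \<cdot>\<^sub>v v;
          V' = mat_of_cols n (cols V @ [w])
      in V \<in> carrier_mat n k \<and> w \<in> carrier_vec n \<and> H \<in> carrier_mat k k \<and>
         col V' 0 = v1 \<and>
         orthonormal_cols V' \<and>
         vspan n (set (cols V')) = vspan n ((\<lambda>i. (A ^\<^sub>m i) *\<^sub>v v1) ` {0..k}) \<and>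
         upper_hessenberg H \<and>
         A * V = V * H + complex_of_real h \<cdot>\<^sub>m outer_prod w (unit_vec k (k - 1)))"

definition harmonic_mat :: "nat \<Rightarrow> complex mat \<Rightarrow> real \<Rightarrow> real \<Rightarrow> complex mat" where
  "harmonic_mat k H h \<gamma> =
     H + complex_of_real (\<gamma> * h\<^sup>2) \<cdot>\<^sub>m
       (inv_adjoint (1\<^sub>m k + complex_of_real \<gamma> \<cdot>\<^sub>m H) *
         outer_prod (unit_vec k (k - 1)) (unit_vec k (k - 1)))"

text \<open>The approximation is the Arnoldi one for \<open>M = H\<close> and the harmonic one for
  \<open>M = harmonic_mat k H h \<gamma>\<close>.\<close>

definition krylov_approx :: "complex mat \<Rightarrow> complex mat \<Rightarrow> real \<Rightarrow> real \<Rightarrow> complex vec" where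
  "krylov_approx V M \<beta> t =
     V *\<^sub>v (mat_exp (complex_of_real (- t) \<cdot>\<^sub>m M) *\<^sub>v
       (complex_of_real \<beta> \<cdot>\<^sub>v unit_vec (dim_row M) 0))"

definition residual :: "complex mat \<Rightarrow> (real \<Rightarrow> complex vec) \<Rightarrow> real \<Rightarrow> complex vec" where
  "residual A y t = - (A *\<^sub>v y t) - vec_deriv y t"

text \<open>The exponential series converges and the approximations are differentiable, so \<open>mat_exp\<close>
  and \<open>residual\<close> never rely on the default values of \<open>suminf\<close> and \<open>vector_derivative\<close>.\<close>

lemma mat_exp_summable:
  fixes A :: "complex mat"
  assumes A: "A \<in> carrier_mat d d" and ij: "i < d" "j < d"
  shows "summable (\<lambda>m. (A ^\<^sub>m m) $$ (i, j) / fact m)"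
proof -
  define C where "C = (\<Sum>j<d. \<Sum>l<d. cmod (A $$ (l, j)))"
  have C0: "C \<ge> 0" unfolding C_def by (intro sum_nonneg) auto
  have colC: "(\<Sum>l<d. cmod (A $$ (l, j))) \<le> C" if "j < d" for j
    unfolding C_def
    by (rule member_le_sum[of j "{..<d}" "\<lambda>j. \<Sum>l<d. cmod (A $$ (l, j))"])
       (use that in \<open>auto intro: sum_nonneg\<close>)
  have bnd: "\<forall>i<d. \<forall>j<d. cmod ((A ^\<^sub>m m) $$ (i, j)) \<le> C ^ m" for m
  proof (induction m)
    case 0
    show ?case using A by auto
  next
    case (Suc m)
    show ?case
    proof (intro allI impI)
      fix i j assume i: "i < d" and j: "j < d"
      have P: "A ^\<^sub>m m \<in> carrier_mat d d" using A by (rule pow_carrier_mat)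
      have "(A ^\<^sub>m Suc m) $$ (i, j) = (\<Sum>l<d. (A ^\<^sub>m m) $$ (i, l) * A $$ (l, j))"
        using P A i j by (simp add: scalar_prod_def atLeast0LessThan)
      also have "cmod \<dots> \<le> (\<Sum>l<d. C ^ m * cmod (A $$ (l, j)))"
        by (rule sum_norm_le) (use Suc i in \<open>auto simp: norm_mult intro!: mult_right_mono\<close>)
      also have "\<dots> = C ^ m * (\<Sum>l<d. cmod (A $$ (l, j)))" by (simp add: sum_distrib_left)
      also have "\<dots> \<le> C ^ m * C" using colC[OF j] C0 by (intro mult_left_mono) auto
      finally show "cmod ((A ^\<^sub>m Suc m) $$ (i, j)) \<le> C ^ Suc m" by (simp add: mult.commute)
    qed
  qed
  show ?thesis
  proof (rule summable_comparison_test')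
    show "summable (\<lambda>m. inverse (fact m) * C ^ m)" by (rule summable_exp)
    show "norm ((A ^\<^sub>m m) $$ (i, j) / fact m) \<le> inverse (fact m) * C ^ m" for m
      using bnd[of m] ij by (simp add: norm_divide field_simps)
  qed
qed

lemma pow_smult_mat:
  fixes A :: "complex mat"
  assumes A: "A \<in> carrier_mat d d"
  shows "(z \<cdot>\<^sub>m A) ^\<^sub>m m = z ^ m \<cdot>\<^sub>m (A ^\<^sub>m m)"
proof (induction m)
  case 0
  show ?case using A by auto
next
  case (Suc m)
  have P: "A ^\<^sub>m m \<in> carrier_mat d d" using A by (rule pow_carrier_mat)
  have "(z \<cdot>\<^sub>m A) ^\<^sub>m Suc m = (z ^ m \<cdot>\<^sub>m (A ^\<^sub>m m)) * (z \<cdot>\<^sub>m A)" using Suc by simp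
  also have "\<dots> = z ^ m \<cdot>\<^sub>m (z \<cdot>\<^sub>m (A ^\<^sub>m m * A))"
    using A P by (simp add: mult_smult_assoc_mat[of _ d d _ d] mult_smult_distrib[OF P A])
  also have "\<dots> = z ^ Suc m \<cdot>\<^sub>m (A ^\<^sub>m Suc m)" using A P by (intro eq_matI) auto
  finally show ?case .
qed

lemma mat_exp_smult_differentiable:
  assumes A: "A \<in> carrier_mat d d" and ij: "i < d" "j < d"
  shows "(\<lambda>z. mat_exp (z \<cdot>\<^sub>m A) $$ (i, j)) field_differentiable at z"
proof -
  define c where "c m = (A ^\<^sub>m m) $$ (i, j) / fact m" for m
  have P: "A ^\<^sub>m m \<in> carrier_mat d d" for m using A by (rule pow_carrier_mat)
  have eq: "((w \<cdot>\<^sub>m A) ^\<^sub>m m) $$ (i, j) / fact m = c m * w ^ m" for w m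
    using A ij P[of m] by (simp add: pow_smult_mat[OF A] c_def)
  have sm: "summable (\<lambda>m. c m * w ^ m)" for w
    using mat_exp_summable[of "w \<cdot>\<^sub>m A" d i j] A ij by (simp add: eq)
  have "mat_exp (w \<cdot>\<^sub>m A) $$ (i, j) = (\<Sum>m. c m * w ^ m)" for w
    using A ij by (simp add: mat_exp_def eq)
  then show ?thesis
    using termdiffs_strong_converges_everywhere[OF sm, of z]
    unfolding field_differentiable_def by auto
qed

lemma krylov_approx_differentiable:
  assumes V: "V \<in> carrier_mat n d" and M: "M \<in> carrier_mat d d" and i: "i < n"
  shows "(\<lambda>s. krylov_approx V M \<beta> s $ i) differentiable at t"
proof -
  let ?E = "\<lambda>s::real. mat_exp (complex_of_real (- s) \<cdot>\<^sub>m M)"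
  have E: "?E s \<in> carrier_mat d d" for s using M by (simp add: mat_exp_def)
  have eq: "krylov_approx V M \<beta> s $ i =
      (\<Sum>l<d. V $$ (i, l) * (\<Sum>j<d. ?E s $$ (l, j) * (complex_of_real \<beta> * (if j = 0 then 1 else 0))))" for s
    unfolding krylov_approx_def using V M i E[of s]
    by (auto simp: scalar_prod_def atLeast0LessThan intro!: sum.cong)
  have "(\<lambda>s. ?E s $$ (l, j)) differentiable at t" if lj: "l < d" "j < d" for l j
  proof -
    have "(\<lambda>z. mat_exp (z \<cdot>\<^sub>m M) $$ (l, j)) differentiable at (complex_of_real (- t))"
      using mat_exp_smult_differentiable[OF M lj] field_differentiable_imp_differentiable by blast
    moreover have "(\<lambda>s. complex_of_real (- s)) differentiable at t"
      by (intro bounded_linear_imp_differentiable bounded_linear_compose[OF bounded_linear_of_real]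
          bounded_linear_minus bounded_linear_ident)
    ultimately show ?thesis
      using differentiable_chain_at[of "\<lambda>s. complex_of_real (- s)" t] by (auto simp: o_def)
  qed
  then show ?thesis unfolding eq
    by (intro differentiable_sum differentiable_mult differentiable_const finite_lessThan ballI) auto
qed

end

theory Submission
  imports Defs
begin

text \<open>The harmonic matrix is a rank one update \<open>T = H + g e\<^sub>k\<^sup>H\<close>, so telescoping gives
  \<open>T\<^sup>m - H\<^sup>m = \<Sum>p<m. H\<^sup>m\<^sup>-\<^sup>1\<^sup>-\<^sup>p g e\<^sub>k\<^sup>H T\<^sup>p\<close>. Applied to \<open>e\<^sub>1\<close>, the term \<open>p = 0\<close> vanishes because \<open>k \<ge> 2\<close>,
  and summing the exponential series yields the difference of the approximations. The Arnoldi
  relation evaluates the residual of any \<open>V exp(-tM) \<beta> e\<^sub>1\<close> with \<open>M = H + g e\<^sub>k\<^sup>H\<close> in closed form; the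
  two residuals are the case above and the case \<open>g = 0\<close>, and \<open>\<alpha>\<close> is the difference of the last
  components of the exponential factors.\<close>

unbundle no vec_syntax

section \<open>Dimensions, inverse adjoint and matrix powers\<close>

lemma mat_exp_mult_vec_carrier [simp]:
  assumes "M \<in> carrier_mat d d" "x \<in> carrier_vec d"
  shows "mat_exp (z \<cdot>\<^sub>m M) *\<^sub>v x \<in> carrier_vec d"
  by (rule mult_mat_vec_carrier[of _ d d]) (use assms in \<open>simp_all add: mat_exp_def\<close>)

lemma pow_mat_mult_vec_carrier [simp]:
  assumes "M \<in> carrier_mat d d" "x \<in> carrier_vec d"
  shows "(M ^\<^sub>m m) *\<^sub>v x \<in> carrier_vec d"
  using assms by (metis mult_mat_vec_carrier pow_carrier_mat)

text \<open>\<open>inv_adjoint\<close> applies \<open>the\<close> to an option, so its size is known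
  only once \<open>mat_inverse\<close> is shown to return a value. Invertibility makes
  \<open>det A\<close> nonzero; the adjoint, being the transpose of the conjugate, then has nonzero
  determinant as well and is a unit.\<close>

lemma inv_adjoint_carrier:
  assumes A: "A \<in> carrier_mat d d" and inv: "invertible_mat A"
  shows "inv_adjoint A \<in> carrier_mat d d"
proof -
  interpret cnj: comm_ring_hom cnj by unfold_locales simp_all
  have adj: "mat_adjoint A = transpose_mat (map_mat cnj A)"
    using A by (intro eq_matI) (auto simp: mat_adjoint_def mat_of_rows_def)
  from inv obtain B where B: "A * B = 1\<^sub>m d" "B * A = 1\<^sub>m (dim_row B)"
    using A unfolding invertible_mat_def inverts_mat_def by auto
  \<comment> \<open>The size of \<open>B\<close> is not part of invertibility: the column count of
    \<open>A * B\<close> gives its columns, that of \<open>B * A\<close> its rows.\<close>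
  then have Bc: "B \<in> carrier_mat d d"
    using A by (metis carrier_matD(2) carrier_matI index_mult_mat(2,3) index_one_mat(2,3))
  have "det A * det B = 1"
    using B(1) by (simp add: det_mult[OF A Bc, symmetric])
  then have "det A \<noteq> 0" by auto
  then have det: "det (mat_adjoint A) \<noteq> 0"
    using A by (simp add: adj det_transpose[of _ d])
  have Ac: "mat_adjoint A \<in> carrier_mat d d" using A by (simp add: adj)
  show ?thesis
  proof (cases "mat_inverse (mat_adjoint A)")
    case None
    from mat_inverse(1)[OF Ac None, of "()"] det_non_zero_imp_unit[OF Ac det, of "()"]
    show ?thesis by contradiction
  next
    case (Some C)
    then show ?thesis using mat_inverse(2)[OF Ac Some] by (simp add: inv_adjoint_def)
  qed
qed

text \<open>The recursion of \<open>pow_mat\<close> adds its factor on the right; advancing a power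
  that acts on a vector needs the new factor on the left.\<close>

lemma pow_mat_Suc_mult_vec:
  fixes M :: "complex mat"
  assumes M: "M \<in> carrier_mat d d" and x: "x \<in> carrier_vec d"
  shows "(M ^\<^sub>m Suc m) *\<^sub>v x = M *\<^sub>v ((M ^\<^sub>m m) *\<^sub>v x)"
proof -
  have "M ^\<^sub>m Suc m = M * M ^\<^sub>m m"
    using M by (induction m) (simp_all add: assoc_mult_mat[of _ d d _ d _ d] pow_carrier_mat)
  then show ?thesis
    using assoc_mult_mat_vec[OF M pow_carrier_mat[OF M] x] by simp
qed

section \<open>Coordinates of products and rank one matrices\<close>

lemma index_mult_mat_vec_sum:
  assumes "M \<in> carrier_mat nr nc" "x \<in> carrier_vec nc" "i < nr"
  shows "(M *\<^sub>v x) $ i = (\<Sum>l<nc. M $$ (i, l) * x $ l)"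
  using assms by (auto simp: scalar_prod_def atLeast0LessThan intro!: sum.cong)

lemma scalar_prod_conj_unit_vec:
  fixes x :: "complex vec"
  assumes "x \<in> carrier_vec d" "j < d"
  shows "x \<bullet>c unit_vec d j = x $ j"
proof -
  have "x \<bullet>c unit_vec d j = (\<Sum>i<d. if i = j then x $ i else 0)"
    using assms by (auto simp: scalar_prod_def atLeast0LessThan unit_vec_def if_distrib cong: if_cong)
  then show ?thesis using assms by simp
qed

text \<open>A unit vector is real, so the conjugation in \<open>outer_prod\<close> has no effect and
  the row factor just reads off coordinate \<open>j\<close>.\<close>

lemma outer_prod_unit_vec_mult_vec:
  assumes "u \<in> carrier_vec n" "x \<in> carrier_vec d" "j < d"
  shows "outer_prod u (unit_vec d j) *\<^sub>v x = x $ j \<cdot>\<^sub>v u"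
proof (rule eq_vecI)
  fix i assume "i < dim_vec (x $ j \<cdot>\<^sub>v u)"
  then have i: "i < n" using assms by simp
  have c: "outer_prod u (unit_vec d j) \<in> carrier_mat n d"
    using assms by (simp add: outer_prod_def)
  have "(outer_prod u (unit_vec d j) *\<^sub>v x) $ i = (\<Sum>l<d. if l = j then u $ i * x $ l else 0)"
    unfolding index_mult_mat_vec_sum[OF c assms(2) i]
    using assms i by (auto simp: outer_prod_def unit_vec_def if_distrib if_distribR cong: if_cong intro!: sum.cong)
  then show "(outer_prod u (unit_vec d j) *\<^sub>v x) $ i = (x $ j \<cdot>\<^sub>v u) $ i"
    using assms i by simp
qed (use assms in \<open>simp add: outer_prod_def\<close>)

lemma mat_mult_outer_prod:
  assumes "B \<in> carrier_mat n d" "u \<in> carrier_vec d"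
  shows "B * outer_prod u z = outer_prod (B *\<^sub>v u) z"
  using assms
  by (intro eq_matI) (auto simp: outer_prod_def scalar_prod_def sum_distrib_right mult.assoc)

lemma smult_outer_prod: "c \<cdot>\<^sub>m outer_prod u z = outer_prod (c \<cdot>\<^sub>v u) z"
  by (intro eq_matI) (auto simp: outer_prod_def)

section \<open>Exponentials and powers of a matrix acting on a vector\<close>

lemma mat_exp_mult_vec_sums:
  assumes M: "M \<in> carrier_mat d d" and x: "x \<in> carrier_vec d" and i: "i < d"
  shows "(\<lambda>m. ((M ^\<^sub>m m) *\<^sub>v x) $ i / fact m * z ^ m) sums (mat_exp (z \<cdot>\<^sub>m M) *\<^sub>v x) $ i"
proof -
  have zM: "z \<cdot>\<^sub>m M \<in> carrier_mat d d" using M by simp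
  have E: "mat_exp (z \<cdot>\<^sub>m M) \<in> carrier_mat d d" using M by (simp add: mat_exp_def)
  have P: "M ^\<^sub>m m \<in> carrier_mat d d" for m using M by (rule pow_carrier_mat)
  \<comment> \<open>A coordinate of the product is a finite combination of convergent entry series,
    so sum and series may be exchanged. Pulling \<open>z ^ m\<close> out of the power then leaves a
    power series in \<open>z\<close>.\<close>
  have "(\<lambda>m. \<Sum>l<d. ((z \<cdot>\<^sub>m M) ^\<^sub>m m) $$ (i, l) / fact m * x $ l)
      sums (\<Sum>l<d. mat_exp (z \<cdot>\<^sub>m M) $$ (i, l) * x $ l)"
    using M i mat_exp_summable[OF zM i]
    by (intro sums_sum sums_mult2) (auto simp: mat_exp_def intro!: summable_sums)
  moreover have "(\<Sum>l<d. ((z \<cdot>\<^sub>m M) ^\<^sub>m m) $$ (i, l) / fact m * x $ l)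
      = ((M ^\<^sub>m m) *\<^sub>v x) $ i / fact m * z ^ m" for m
    unfolding pow_smult_mat[OF M] index_mult_mat_vec_sum[OF P x i] sum_divide_distrib sum_distrib_right
    using carrier_matD[OF P] i by (intro sum.cong refl) (simp add: mult_ac)
  ultimately show ?thesis
    by (simp add: index_mult_mat_vec_sum[OF E x i])
qed

text \<open>The coordinate is an everywhere convergent power series, hence differentiable term by
  term. In \<open>diffs c\<close> the factor \<open>Suc m\<close> reduces
  \<open>fact (Suc m)\<close> to \<open>fact m\<close>, and the surplus factor \<open>M\<close> of
  the power moves in front of the exponential.\<close>

lemma mat_exp_mult_vec_has_field_derivative:
  assumes M: "M \<in> carrier_mat d d" and x: "x \<in> carrier_vec d" and i: "i < d"
  shows "((\<lambda>z. (mat_exp (z \<cdot>\<^sub>m M) *\<^sub>v x) $ i) has_field_derivative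
    (M *\<^sub>v (mat_exp (z \<cdot>\<^sub>m M) *\<^sub>v x)) $ i) (at z)"
proof -
  define c where "c m = ((M ^\<^sub>m m) *\<^sub>v x) $ i / fact m" for m
  have S: "(\<lambda>m. c m * z ^ m) sums (mat_exp (z \<cdot>\<^sub>m M) *\<^sub>v x) $ i" for z
    unfolding c_def by (rule mat_exp_mult_vec_sums[OF M x i])
  have Px: "(M ^\<^sub>m m) *\<^sub>v x \<in> carrier_vec d" for m
    using M x by simp
  have Ex: "mat_exp (z \<cdot>\<^sub>m M) *\<^sub>v x \<in> carrier_vec d"
    using M x by simp
  have "(\<lambda>m. \<Sum>l<d. M $$ (i, l) * (((M ^\<^sub>m m) *\<^sub>v x) $ l / fact m * z ^ m))
      sums (\<Sum>l<d. M $$ (i, l) * (mat_exp (z \<cdot>\<^sub>m M) *\<^sub>v x) $ l)"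
    by (intro sums_sum sums_mult mat_exp_mult_vec_sums[OF M x]) auto
  moreover have "(\<Sum>l<d. M $$ (i, l) * (((M ^\<^sub>m m) *\<^sub>v x) $ l / fact m * z ^ m))
      = diffs c m * z ^ m" for m
    unfolding diffs_def c_def pow_mat_Suc_mult_vec[OF M x]
      index_mult_mat_vec_sum[OF M Px i] sum_divide_distrib sum_distrib_left sum_distrib_right
    by (intro sum.cong) (simp_all add: field_simps del: of_nat_Suc)
  ultimately have "(\<Sum>m. diffs c m * z ^ m) = (M *\<^sub>v (mat_exp (z \<cdot>\<^sub>m M) *\<^sub>v x)) $ i"
    by (simp add: index_mult_mat_vec_sum[OF M Ex i] sums_iff)
  moreover have "(\<lambda>z. (mat_exp (z \<cdot>\<^sub>m M) *\<^sub>v x) $ i) = (\<lambda>z. \<Sum>m. c m * z ^ m)"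
    using S by (auto simp: sums_iff)
  ultimately show ?thesis
    using termdiffs_strong_converges_everywhere[of c z] S by (metis sums_summable)
qed

text \<open>Induction on \<open>m\<close>: one more factor \<open>T\<close> applies \<open>H\<close>
  to the previous vector and adds coordinate \<open>j\<close> of that vector times \<open>g\<close>.
  The added term is the summand \<open>p = m\<close>, while \<open>H\<close> raises the power of
  \<open>H\<close> in each earlier summand by one.\<close>

lemma pow_mat_rank_one_update:
  assumes H: "H \<in> carrier_mat d d" and g: "g \<in> carrier_vec d" and x: "x \<in> carrier_vec d"
    and j: "j < d" and i: "i < d"
  defines "T \<equiv> H + outer_prod g (unit_vec d j)"
  shows "((T ^\<^sub>m m) *\<^sub>v x) $ i = ((H ^\<^sub>m m) *\<^sub>v x) $ i
    + (\<Sum>p<m. ((T ^\<^sub>m p) *\<^sub>v x) $ j * ((H ^\<^sub>m (m - 1 - p)) *\<^sub>v g) $ i)"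
  using i
proof (induction m arbitrary: i)
  case 0
  then show ?case using H g by (simp add: T_def outer_prod_def)
next
  case (Suc m)
  have O: "outer_prod g (unit_vec d j) \<in> carrier_mat d d" using g by (simp add: outer_prod_def)
  then have T: "T \<in> carrier_mat d d" using H by (simp add: T_def)
  have Tx: "(T ^\<^sub>m m) *\<^sub>v x \<in> carrier_vec d"
    using T x by simp
  have Hx: "(H ^\<^sub>m m) *\<^sub>v x \<in> carrier_vec d"
    using H x by simp
  have Hg: "(H ^\<^sub>m q) *\<^sub>v g \<in> carrier_vec d" for q
    using H g by simp
  let ?f = "\<lambda>p. ((T ^\<^sub>m p) *\<^sub>v x) $ j"
  \<comment> \<open>The bound \<open>p < m\<close> keeps the natural number subtraction from
    truncating.\<close>
  have step: "(H *\<^sub>v ((H ^\<^sub>m (m - Suc p)) *\<^sub>v g)) $ i = ((H ^\<^sub>m (m - p)) *\<^sub>v g) $ i" if "p < m" for p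
    using that pow_mat_Suc_mult_vec[OF H g, of "m - Suc p"] by (simp add: Suc_diff_Suc del: pow_mat.simps)
  have "((T ^\<^sub>m Suc m) *\<^sub>v x) $ i = (H *\<^sub>v ((T ^\<^sub>m m) *\<^sub>v x)) $ i + ?f m * g $ i"
    unfolding pow_mat_Suc_mult_vec[OF T x]
    using Suc.prems H g
    by (simp add: T_def add_mult_distrib_mat_vec[OF H O Tx, unfolded T_def]
        outer_prod_unit_vec_mult_vec[OF g Tx[unfolded T_def] j])
  also have "(H *\<^sub>v ((T ^\<^sub>m m) *\<^sub>v x)) $ i = (H *\<^sub>v ((H ^\<^sub>m m) *\<^sub>v x)) $ i
      + (\<Sum>l<d. \<Sum>p<m. ?f p * (H $$ (i, l) * ((H ^\<^sub>m (m - 1 - p)) *\<^sub>v g) $ l))"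
    unfolding index_mult_mat_vec_sum[OF H Tx Suc.prems] index_mult_mat_vec_sum[OF H Hx Suc.prems]
      sum.distrib[symmetric]
    \<comment> \<open>Row \<open>i\<close> of \<open>H\<close> involves all coordinates, so the
      induction hypothesis is used at every \<open>l < d\<close>; this is why \<open>i\<close> is
      generalized.\<close>
    by (intro sum.cong) (simp_all add: Suc.IH distrib_left sum_distrib_left mult_ac)
  also have "(\<Sum>l<d. \<Sum>p<m. ?f p * (H $$ (i, l) * ((H ^\<^sub>m (m - 1 - p)) *\<^sub>v g) $ l))
      = (\<Sum>p<m. ?f p * ((H ^\<^sub>m (m - p)) *\<^sub>v g) $ i)"
    by (subst sum.swap, intro sum.cong)
       (simp_all add: sum_distrib_left[symmetric] index_mult_mat_vec_sum[OF H Hg Suc.prems, symmetric] step)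
  finally show ?case
    using H g by (simp add: pow_mat_Suc_mult_vec[OF H x] del: pow_mat.simps(2))
qed

section \<open>Derivatives and residuals of Krylov approximations\<close>

lemma vec_deriv_krylov_approx:
  fixes \<beta> :: real
  assumes V: "V \<in> carrier_mat n d" and M: "M \<in> carrier_mat d d"
  defines "E \<equiv> \<lambda>s::real. mat_exp (complex_of_real (- s) \<cdot>\<^sub>m M) *\<^sub>v (complex_of_real \<beta> \<cdot>\<^sub>v unit_vec d 0)"
  shows "vec_deriv (krylov_approx V M \<beta>) t = - (V *\<^sub>v (M *\<^sub>v E t))"
proof -
  let ?x = "complex_of_real \<beta> \<cdot>\<^sub>v unit_vec d 0"
  have E: "E s \<in> carrier_vec d" for s unfolding E_def using M by (intro mat_exp_mult_vec_carrier) simp_all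
  have kE: "krylov_approx V M \<beta> s = V *\<^sub>v E s" for s
    using M by (simp add: krylov_approx_def E_def)
  have ME: "M *\<^sub>v E t \<in> carrier_vec d" using M E by simp
  have "((\<lambda>s. krylov_approx V M \<beta> s $ i) has_vector_derivative - (V *\<^sub>v (M *\<^sub>v E t)) $ i) (at t)"
    if i: "i < n" for i
  proof -
    have D: "((\<lambda>s. E s $ l) has_vector_derivative - (M *\<^sub>v E t) $ l) (at t)" if l: "l < d" for l
    proof -
      have "((\<lambda>s. complex_of_real (- s)) has_vector_derivative - 1) (at t)"
        by (auto intro!: derivative_eq_intros)
      moreover have "((\<lambda>z. (mat_exp (z \<cdot>\<^sub>m M) *\<^sub>v ?x) $ l) has_field_derivative (M *\<^sub>v E t) $ l)
          (at (complex_of_real (- t)))"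
        unfolding E_def by (rule mat_exp_mult_vec_has_field_derivative[OF M _ l]) simp
      \<comment> \<open>The complex derivative is composed with the real curve \<open>s\<close> to
        \<open>- s\<close>, which contributes the minus sign.\<close>
      ultimately have "((\<lambda>z. (mat_exp (z \<cdot>\<^sub>m M) *\<^sub>v ?x) $ l) \<circ> (\<lambda>s. complex_of_real (- s))
          has_vector_derivative - 1 * (M *\<^sub>v E t) $ l) (at t)"
        by (rule field_vector_diff_chain_at)
      moreover have "(\<lambda>z. (mat_exp (z \<cdot>\<^sub>m M) *\<^sub>v ?x) $ l) \<circ> (\<lambda>s. complex_of_real (- s)) = (\<lambda>s. E s $ l)"
        by (simp only: o_def E_def)
      ultimately show ?thesis by simp
    qed
    have "((\<lambda>s. \<Sum>l<d. V $$ (i, l) * E s $ l) has_vector_derivative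
        (\<Sum>l<d. V $$ (i, l) * - (M *\<^sub>v E t) $ l)) (at t)"
      by (intro has_vector_derivative_sum has_vector_derivative_mult_right D) auto
    then show ?thesis
      unfolding kE index_mult_mat_vec_sum[OF V E i] index_mult_mat_vec_sum[OF V ME i]
      by (simp add: sum_negf)
  qed
  then have "vector_derivative (\<lambda>s. krylov_approx V M \<beta> s $ i) (at t) = - (V *\<^sub>v (M *\<^sub>v E t)) $ i"
    if "i < n" for i
    using that by (intro vector_derivative_at)
  moreover have "dim_vec (krylov_approx V M \<beta> t) = n" using V by (simp add: kE)
  ultimately show ?thesis
    using V by (intro eq_vecI) (simp_all add: vec_deriv_def)
qed

text \<open>The Arnoldi relation splits \<open>A *\<^sub>v (V *\<^sub>v E)\<close> into
  \<open>V *\<^sub>v (H *\<^sub>v E)\<close> and a multiple of \<open>w\<close>; the derivative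
  contributes the same vector with opposite sign in the residual, plus a multiple of
  \<open>V *\<^sub>v g\<close>. Only the two rank one terms survive.\<close>

lemma residual_krylov_approx:
  fixes \<eta> :: complex and \<beta> t :: real and E :: "complex vec"
  assumes A: "A \<in> carrier_mat n n" and V: "V \<in> carrier_mat n d" and H: "H \<in> carrier_mat d d"
    and w: "w \<in> carrier_vec n" and g: "g \<in> carrier_vec d" and j: "j < d"
    and AV: "A * V = V * H + \<eta> \<cdot>\<^sub>m outer_prod w (unit_vec d j)"
    and M: "M = H + outer_prod g (unit_vec d j)"
  defines "E \<equiv> mat_exp (complex_of_real (- t) \<cdot>\<^sub>m M) *\<^sub>v (complex_of_real \<beta> \<cdot>\<^sub>v unit_vec d 0)"
  shows "residual A (krylov_approx V M \<beta>) t = E $ j \<cdot>\<^sub>v (V *\<^sub>v g) - (\<eta> * E $ j) \<cdot>\<^sub>v w"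
proof -
  have Og: "outer_prod g (unit_vec d j) \<in> carrier_mat d d" using g by (simp add: outer_prod_def)
  have Ow: "outer_prod (\<eta> \<cdot>\<^sub>v w) (unit_vec d j) \<in> carrier_mat n d" using w by (simp add: outer_prod_def)
  have Mc: "M \<in> carrier_mat d d" using M H Og by simp
  have E: "E \<in> carrier_vec d" unfolding E_def using Mc by (intro mat_exp_mult_vec_carrier) simp_all
  have HE: "H *\<^sub>v E \<in> carrier_vec d" using H E by simp
  have "A *\<^sub>v (V *\<^sub>v E) = V *\<^sub>v (H *\<^sub>v E) + \<eta> \<cdot>\<^sub>v (E $ j \<cdot>\<^sub>v w)"
    unfolding assoc_mult_mat_vec[OF A V E, symmetric] AV smult_outer_prod
    using V H E Ow w
    by (simp add: add_mult_distrib_mat_vec[of _ n d] assoc_mult_mat_vec[of _ n d _ d]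
        outer_prod_unit_vec_mult_vec[of _ n _ d] smult_smult_assoc j mult.commute)
  moreover have "V *\<^sub>v (M *\<^sub>v E) = V *\<^sub>v (H *\<^sub>v E) + E $ j \<cdot>\<^sub>v (V *\<^sub>v g)"
    unfolding M add_mult_distrib_mat_vec[OF H Og E] outer_prod_unit_vec_mult_vec[OF g E j]
    using V HE g by (simp add: mult_add_distrib_mat_vec[OF V HE] mult_mat_vec[OF V g])
  moreover have "krylov_approx V M \<beta> t = V *\<^sub>v E"
    using Mc by (simp add: krylov_approx_def E_def)
  ultimately show ?thesis
    unfolding residual_def vec_deriv_krylov_approx[OF V Mc, of \<beta> t, folded E_def]
    using V w g HE by (intro eq_vecI) (auto simp: algebra_simps)
qed

section \<open>Comparison of the Arnoldi and harmonic Arnoldi approximations\<close>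

theorem theorem3p1:
  fixes n k :: nat
    and A V H T :: "complex mat"
    and v w g :: "complex vec"
    and h \<gamma> t \<beta> :: real
    and \<alpha> :: complex
    and y yhat :: "real \<Rightarrow> complex vec"
    and S :: "nat \<Rightarrow> complex vec"
    and s :: "nat \<Rightarrow> complex"
  assumes k: "k \<ge> 2"
    and A: "A \<in> carrier_mat n n"
    and v: "v \<in> carrier_vec n" "v \<noteq> 0\<^sub>v n"
    and t: "t > 0"
    and spec: "\<forall>z \<in> spectrum (complex_of_real (- t) \<cdot>\<^sub>m A). Re z \<le> 0"
    and arn: "arnoldi n k A v V w H h"
    and gam: "\<gamma> \<noteq> 0" "invertible_mat (1\<^sub>m k + complex_of_real \<gamma> \<cdot>\<^sub>m H)"
    and "\<beta> = norm2 v"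
    and "T = harmonic_mat k H h \<gamma>"
    and "y = krylov_approx V H \<beta>"
    and "yhat = krylov_approx V T \<beta>"
    and "g = complex_of_real (\<gamma> * h\<^sup>2) \<cdot>\<^sub>v
           (inv_adjoint (1\<^sub>m k + complex_of_real \<gamma> \<cdot>\<^sub>m H) *\<^sub>v unit_vec k (k - 1))"
    and "S = (\<lambda>m. complex_of_real ((- t) ^ m / fact m) \<cdot>\<^sub>v
           finsum_vec TYPE(complex) k
             (\<lambda>p. (((T ^\<^sub>m p) *\<^sub>v unit_vec k 0) \<bullet>c unit_vec k (k - 1)) \<cdot>\<^sub>v ((H ^\<^sub>m (m - 1 - p)) *\<^sub>v g))
             {1..m - 1})"
    and "s = (\<lambda>m. complex_of_real ((- t) ^ m / fact m) *
           (\<Sum>p = 1..m - 1. (((T ^\<^sub>m p) *\<^sub>v unit_vec k 0) \<bullet>c unit_vec k (k - 1)) *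
                           (((H ^\<^sub>m (m - 1 - p)) *\<^sub>v g) \<bullet>c unit_vec k (k - 1))))"
    and "\<alpha> = complex_of_real \<beta> * (\<Sum>m. s (m + 2))"
  shows "vec_summable k (\<lambda>m. S (m + 2))
    \<and> yhat t = y t + complex_of_real \<beta> \<cdot>\<^sub>v (V *\<^sub>v vec_suminf k (\<lambda>m. S (m + 2)))
    \<and> summable (\<lambda>m. s (m + 2))
    \<and> residual A yhat t =
           residual A y t
           - (complex_of_real h * \<alpha>) \<cdot>\<^sub>v w
           + (complex_of_real (\<gamma> * h\<^sup>2) *
               ((mat_exp (complex_of_real (- t) \<cdot>\<^sub>m H) *\<^sub>v (complex_of_real \<beta> \<cdot>\<^sub>v unit_vec k 0))
                  \<bullet>c unit_vec k (k - 1) + \<alpha>))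
             \<cdot>\<^sub>v (V *\<^sub>v (inv_adjoint (1\<^sub>m k + complex_of_real \<gamma> \<cdot>\<^sub>m H) *\<^sub>v unit_vec k (k - 1)))"
proof -
  let ?j = "k - 1" and ?x = "unit_vec k 0 :: complex vec"
  let ?N = "inv_adjoint (1\<^sub>m k + complex_of_real \<gamma> \<cdot>\<^sub>m H)"
  let ?c = "complex_of_real (\<gamma> * h\<^sup>2)" and ?\<beta> = "complex_of_real \<beta>"
  let ?z = "complex_of_real (- t)"
  let ?u = "?N *\<^sub>v unit_vec k ?j"
  \<comment> \<open>The defining equations, in the order \<beta>, \<open>T\<close>,
    \<open>y\<close>, \<open>yhat\<close>, \<open>g\<close>, \<open>S\<close>, \<open>s\<close>,
    \<alpha>.\<close>
  note defs = assms(10-)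
  have j: "?j < k" "0 < k" "?j \<noteq> 0" using k by auto
  have V: "V \<in> carrier_mat n k" and w: "w \<in> carrier_vec n" and H: "H \<in> carrier_mat k k"
    and AV: "A * V = V * H + complex_of_real h \<cdot>\<^sub>m outer_prod w (unit_vec k ?j)"
    using arn by (auto simp: arnoldi_def Let_def)
  have N: "?N \<in> carrier_mat k k"
    using gam(2) H by (intro inv_adjoint_carrier) auto
  have u: "?u \<in> carrier_vec k" using N by (intro mult_mat_vec_carrier[of _ k k]) auto
  have gu: "g = ?c \<cdot>\<^sub>v ?u" by (fact defs(5))
  have g: "g \<in> carrier_vec k" using u by (simp add: gu)
  \<comment> \<open>The inverse adjoint and the scalar are absorbed into the left factor of the
    outer product, which becomes \<open>g\<close>.\<close>
  have Hupd: "T = H + outer_prod g (unit_vec k ?j)"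
    using N by (simp add: defs(2) harmonic_mat_def mat_mult_outer_prod[of _ k k] smult_outer_prod gu)
  have T: "T \<in> carrier_mat k k" using H g by (simp add: Hupd outer_prod_def)
  let ?f = "\<lambda>p. ((T ^\<^sub>m p) *\<^sub>v ?x) $ ?j"
  define eT where "eT = mat_exp (?z \<cdot>\<^sub>m T) *\<^sub>v ?x"
  define eH where "eH = mat_exp (?z \<cdot>\<^sub>m H) *\<^sub>v ?x"
  have Tx: "(T ^\<^sub>m p) *\<^sub>v ?x \<in> carrier_vec k" and Hg: "(H ^\<^sub>m p) *\<^sub>v g \<in> carrier_vec k" for p
    using T H g by simp_all
  have ET: "eT \<in> carrier_vec k" and EH: "eH \<in> carrier_vec k"
    unfolding eT_def eH_def by (intro mat_exp_mult_vec_carrier T H unit_vec_carrier)+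
  have fe: "((T ^\<^sub>m p) *\<^sub>v ?x) \<bullet>c unit_vec k ?j = ?f p" for p
    by (rule scalar_prod_conj_unit_vec[OF Tx j(1)])
  have ge: "((H ^\<^sub>m p) *\<^sub>v g) \<bullet>c unit_vec k ?j = ((H ^\<^sub>m p) *\<^sub>v g) $ ?j" for p
    by (rule scalar_prod_conj_unit_vec[OF Hg j(1)])
  have S_index: "S m $ i = complex_of_real ((- t) ^ m / fact m) *
      (\<Sum>p = 1..m - 1. ?f p * ((H ^\<^sub>m (m - 1 - p)) *\<^sub>v g) $ i)" if i: "i < k" for m i
  proof -
    let ?F = "\<lambda>p. ?f p \<cdot>\<^sub>v ((H ^\<^sub>m (m - 1 - p)) *\<^sub>v g)"
    \<comment> \<open>Coordinates can be taken inside \<open>finsum_vec\<close> once all summands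
      lie in the carrier.\<close>
    have F: "?F \<in> {1..m - 1} \<rightarrow> carrier_vec k" using Hg by auto
    have d: "dim_vec (finsum_vec TYPE(complex) k ?F {1..m - 1}) = k"
      using finsum_vec_closed[OF F] by simp
    have "S m $ i = complex_of_real ((- t) ^ m / fact m) * finsum_vec TYPE(complex) k ?F {1..m - 1} $ i"
      unfolding defs(6) fe using d i by simp
    also have "finsum_vec TYPE(complex) k ?F {1..m - 1} $ i = (\<Sum>p = 1..m - 1. ?F p $ i)"
      by (rule index_finsum_vec[OF _ i F]) simp
    also have "\<dots> = (\<Sum>p = 1..m - 1. ?f p * ((H ^\<^sub>m (m - 1 - p)) *\<^sub>v g) $ i)"
      using i carrier_vecD[OF Hg] by (intro sum.cong) simp_all
    finally show ?thesis .
  qed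
  \<comment> \<open>The scalar series behind \<alpha> is the last coordinate of the vector series,
    so one convergence result serves both.\<close>
  have s_S: "s m = S m $ ?j" for m
    unfolding S_index[OF j(1)] defs(7) fe ge ..
  have S_sums: "(\<lambda>m. S (m + 2) $ i) sums (eT $ i - eH $ i)" if i: "i < k" for i
  proof -
    have "S m $ i = ((T ^\<^sub>m m) *\<^sub>v ?x) $ i / fact m * ?z ^ m - ((H ^\<^sub>m m) *\<^sub>v ?x) $ i / fact m * ?z ^ m" for m
    proof -
      \<comment> \<open>This value is the last coordinate of the first unit vector, zero because
        \<open>k \<ge> 2\<close>. Dropping it turns the range \<open>p < m\<close> into
        \<open>1..m - 1\<close>.\<close>
      have "?f 0 = 0" using T j by simp
      then have "(\<Sum>p<m. ?f p * ((H ^\<^sub>m (m - 1 - p)) *\<^sub>v g) $ i)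
          = (\<Sum>p = 1..m - 1. ?f p * ((H ^\<^sub>m (m - 1 - p)) *\<^sub>v g) $ i)"
        by (intro sum.mono_neutral_right) (auto simp: not_le less_eq_Suc_le[symmetric])
      then have "((T ^\<^sub>m m) *\<^sub>v ?x) $ i - ((H ^\<^sub>m m) *\<^sub>v ?x) $ i
          = (\<Sum>p = 1..m - 1. ?f p * ((H ^\<^sub>m (m - 1 - p)) *\<^sub>v g) $ i)"
        using pow_mat_rank_one_update[OF H g _ j(1) i, of ?x m, folded Hupd] by simp
      then show ?thesis
        by (simp only: S_index[OF i] flip: left_diff_distrib diff_divide_distrib) simp
    qed
    then have "(\<lambda>m. S m $ i) sums (eT $ i - eH $ i)"
      using sums_diff[OF mat_exp_mult_vec_sums[OF T _ i, of ?x ?z, folded eT_def]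
          mat_exp_mult_vec_sums[OF H _ i, of ?x ?z, folded eH_def]]
      by simp
    \<comment> \<open>For \<open>m < 2\<close> the inner range is empty, so starting the series at 2
      does not change its sum.\<close>
    moreover have "S m $ i = 0" if "m < 2" for m
      using that by (auto simp: S_index[OF i] less_2_cases_iff)
    ultimately show ?thesis
      using sums_iff_shift[of "\<lambda>m. S m $ i" 2] by (simp add: numeral_2_eq_2)
  qed
  have alpha: "\<alpha> = ?\<beta> * (eT $ ?j - eH $ ?j)"
    using sums_unique[OF S_sums[OF j(1)]] by (simp add: defs(8) s_S)
  have smult: "mat_exp (?z \<cdot>\<^sub>m M) *\<^sub>v (?\<beta> \<cdot>\<^sub>v ?x) = ?\<beta> \<cdot>\<^sub>v (mat_exp (?z \<cdot>\<^sub>m M) *\<^sub>v ?x)"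
    if "M \<in> carrier_mat k k" for M
    using that by (intro mult_mat_vec[of _ k k]) (simp_all add: mat_exp_def)
  note smult_T = smult[OF T, folded eT_def] and smult_H = smult[OF H, folded eH_def]
  have approx: "yhat t = V *\<^sub>v (?\<beta> \<cdot>\<^sub>v eT)" "y t = V *\<^sub>v (?\<beta> \<cdot>\<^sub>v eH)"
    using T H by (simp_all only: defs(3,4) krylov_approx_def carrier_matD smult_T smult_H)
  have "vec_suminf k (\<lambda>m. S (m + 2)) = eT - eH"
    using ET EH sums_unique[OF S_sums] by (intro eq_vecI) (simp_all add: vec_suminf_def)
  then have "yhat t = y t + ?\<beta> \<cdot>\<^sub>v (V *\<^sub>v vec_suminf k (\<lambda>m. S (m + 2)))"
    using V ET EH
    by (intro eq_vecI)
       (auto simp: approx mult_mat_vec[OF V] mult_minus_distrib_mat_vec[OF V] algebra_simps)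
  moreover have "vec_summable k (\<lambda>m. S (m + 2))"
    using S_sums by (auto simp: vec_summable_def sums_iff)
  moreover have "summable (\<lambda>m. s (m + 2))"
    using S_sums[OF j(1)] by (simp add: s_S sums_iff)
  moreover have "residual A yhat t = residual A y t - (complex_of_real h * \<alpha>) \<cdot>\<^sub>v w
      + (?c * ((mat_exp (?z \<cdot>\<^sub>m H) *\<^sub>v (?\<beta> \<cdot>\<^sub>v ?x)) \<bullet>c unit_vec k ?j + \<alpha>)) \<cdot>\<^sub>v (V *\<^sub>v ?u)"
  proof -
    have H0: "H = H + outer_prod (0\<^sub>v k) (unit_vec k ?j)"
      using H by (intro eq_matI) (auto simp: outer_prod_def)
    have "residual A yhat t = (?\<beta> * eT $ ?j) \<cdot>\<^sub>v (?c \<cdot>\<^sub>v (V *\<^sub>v ?u))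
        - (complex_of_real h * (?\<beta> * eT $ ?j)) \<cdot>\<^sub>v w"
      using residual_krylov_approx[OF A V H w g j(1) AV Hupd, of \<beta> t] ET j
      by (simp only: defs(4) smult_T gu mult_mat_vec[OF V u]) simp
    moreover have "residual A y t = (?\<beta> * eH $ ?j) \<cdot>\<^sub>v (V *\<^sub>v 0\<^sub>v k)
        - (complex_of_real h * (?\<beta> * eH $ ?j)) \<cdot>\<^sub>v w"
      using residual_krylov_approx[OF A V H w zero_carrier_vec j(1) AV H0, of \<beta> t] EH j
      by (simp only: defs(3) smult_H) simp
    moreover have "V *\<^sub>v 0\<^sub>v k = 0\<^sub>v n" using V by auto
    moreover have "(mat_exp (?z \<cdot>\<^sub>m H) *\<^sub>v (?\<beta> \<cdot>\<^sub>v ?x)) \<bullet>c unit_vec k ?j = ?\<beta> * eH $ ?j"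
      using EH j by (simp only: smult_H scalar_prod_conj_unit_vec[OF smult_carrier_vec[THEN iffD2, OF EH]]) simp
    \<comment> \<open>By \<open>alpha\<close>, the harmonic coefficient
      \<open>?\<beta> * eT $ ?j\<close> equals \<open>?\<beta> * eH $ ?j + \<alpha>\<close>. In the
      \<open>w\<close> term this separates the Arnoldi residual from the correction by \<alpha>; in
      the other term it is the bracket of the claim.\<close>
    ultimately show ?thesis
      using V w u by (intro eq_vecI) (auto simp: alpha algebra_simps)
  qed
  ultimately show ?thesis by blast
qed

end
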